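(* For every integer $k>0$, every deterministic finite automaton recognizing $\mathtt{MODXOR}_k$ has at least $2^{2k}$ states.
   Context: For $k>0$, $\mathtt{MODXOR}_k\subseteq\{0,1\}^*$ is the set of strings of the form $w_0\,x_1\,u_1\,x_2\,u_2\cdots x_m\,u_m$ where $m>0$, $w_0\in\{0,1\}^*$ has length less than $2k$, each $x_i\in\{0,1\}$, each $u_i\in\{0,1\}^{2k-1}$, and $x_1\oplus x_2\oplus\cdots\oplus x_m=1$. *)

theory Defs
  imports Main
begin

text \<open>Deterministic finite automata with a total transition function; the input alphabet is
  the whole type \<open>'a\<close>, while the state set is an explicit carrier, so that it is finite
  without any restriction on the type \<open>'q\<close>.\<close>

record ('q, 'a) dfa =
  states :: "'q set"
  init :: 'q
  step :: "'q \<Rightarrow> 'a \<Rightarrow> 'q"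
  accepting :: "'q set"

definition is_dfa :: "('q, 'a::finite) dfa \<Rightarrow> bool" where
  "is_dfa M \<longleftrightarrow>
     finite (states M) \<and> init M \<in> states M \<and> accepting M \<subseteq> states M \<and>
     (\<forall>q\<in>states M. \<forall>a. step M q a \<in> states M)"

definition language :: "('q, 'a::finite) dfa \<Rightarrow> 'a list set" where
  "language M = {w. foldl (step M) (init M) w \<in> accepting M}"

text \<open>Bits are Booleans (\<open>True\<close> is 1), and on Booleans \<open>\<noteq>\<close> is exclusive or. The list \<open>bs\<close>
  holds the blocks \<open>(x\<^sub>1, u\<^sub>1), \<dots>, (x\<^sub>m, u\<^sub>m)\<close>.\<close>

definition MODXOR :: "nat \<Rightarrow> bool list set" where
  "MODXOR k = {w0 @ concat (map (\<lambda>(x, u). x # u) bs) | w0 bs.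
     length w0 < 2 * k \<and> bs \<noteq> [] \<and>
     (\<forall>(x, u)\<in>set bs. length u = 2 * k - 1) \<and>
     foldr (\<noteq>) (map fst bs) False = True}"

end

theory Submission
  imports Defs
begin

text \<open>The block starts of a word are exactly the positions at distance a positive multiple of
  \<open>2k\<close> from its end. Hence appending \<open>i\<close> bits to a word \<open>w\<close> of length \<open>2k\<close>, with \<open>i < 2k\<close>,
  gives a single block starting with the \<open>i\<close>-th bit of \<open>w\<close>, so this suffix distinguishes any two
  words of length \<open>2k\<close> that differ at position \<open>i\<close>: they all lead to different states.\<close>

lemma length_concat_blocks:
  assumes "k > 0" and "\<forall>(x, u)\<in>set bs. length u = 2 * k - 1"
  shows "length (concat (map (\<lambda>(x, u). x # u) bs)) = 2 * k * length bs"
  using assms(2) by (induction bs) (use assms(1) in auto)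

lemma append_in_MODXOR_iff:
  assumes "length w = 2 * k" and "length z = i" and "i < 2 * k"
  shows "w @ z \<in> MODXOR k \<longleftrightarrow> w ! i"
proof
  assume "w @ z \<in> MODXOR k"
  then obtain w0 bs where split: "w @ z = w0 @ concat (map (\<lambda>(x, u). x # u) bs)"
    and w0: "length w0 < 2 * k" and "bs \<noteq> []"
    and blocks: "\<forall>(x, u)\<in>set bs. length u = 2 * k - 1"
    and parity: "foldr (\<noteq>) (map fst bs) False"
    unfolding MODXOR_def by auto
  have len: "2 * k + i = length w0 + 2 * k * length bs"
    using arg_cong[OF split, of length] length_concat_blocks[OF _ blocks] assms by simp
  \<comment> \<open>Two blocks alone would take \<open>4 * k\<close> bits, but \<open>w @ z\<close>
    has only \<open>2 * k + i < 4 * k\<close>.\<close>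
  have "length bs = 1"
  proof (rule ccontr)
    assume "length bs \<noteq> 1"
    with \<open>bs \<noteq> []\<close> have "2 \<le> length bs"
      \<comment> \<open>This rule splits lists into empty, singleton and longer ones.\<close>
      by (cases bs rule: remdups_adj.cases) auto
    then have "2 * k * 2 \<le> 2 * k * length bs"
      by (rule mult_le_mono2)
    with len assms(3) show False by linarith
  qed
  then obtain x u where bs: "bs = [(x, u)]"
    by (cases bs) auto
  with len have "length w0 = i" by simp
  then have "(w @ z) ! i = x"
    by (simp add: split bs nth_append)
  \<comment> \<open>As \<open>i < 2 * k\<close>, position \<open>i\<close> lies in \<open>w\<close>;
    the parity of a single block is \<open>x\<close> itself.\<close>
  with parity assms show "w ! i"
    by (simp add: bs nth_append)
next
  assume "w ! i"
  \<comment> \<open>The \<open>2 * k - 1 - i\<close> bits of \<open>w\<close> after position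
    \<open>i\<close> and the \<open>i\<close> bits of \<open>z\<close> together fill exactly one
    \<open>u\<close>.\<close>
  with assms have "w @ z = take i w @ concat (map (\<lambda>(x, u). x # u) [(True, drop (Suc i) w @ z)])"
    using id_take_nth_drop[of i w] by simp
  moreover have "length (drop (Suc i) w @ z) = 2 * k - 1"
    using assms by simp
  ultimately show "w @ z \<in> MODXOR k"
    unfolding MODXOR_def using assms
    by (intro CollectI exI[of _ "take i w"] exI[of _ "[(True, drop (Suc i) w @ z)]"]) auto
qed

lemma foldl_step_in_states:
  assumes "is_dfa M" and "q \<in> states M"
  shows "foldl (step M) q w \<in> states M"
  using assms(2) by (induction w arbitrary: q) (use assms(1) in \<open>auto simp: is_dfa_def\<close>)

theorem theorem9:
  fixes k :: nat and M :: "('q, bool) dfa"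
  assumes "k > 0"
    and "is_dfa M"
    and "language M = MODXOR k"
  shows "card (states M) \<ge> 2 ^ (2 * k)"
proof -
  let ?run = "foldl (step M) (init M)"
  let ?W = "{w :: bool list. length w = 2 * k}"
  have "inj_on ?run ?W"
  proof (rule inj_onI)
    fix v w
    assume v: "v \<in> ?W" and w: "w \<in> ?W" and same: "?run v = ?run w"
    have "v ! i \<longleftrightarrow> w ! i" if "i < 2 * k" for i
    proof -
      \<comment> \<open>Only the length of the suffix matters; its bits are an arbitrary
        choice.\<close>
      let ?z = "replicate i False"
      have "v @ ?z \<in> language M \<longleftrightarrow> w @ ?z \<in> language M"
        by (simp add: language_def same)
      with v w that show ?thesis
        by (simp add: assms(3) append_in_MODXOR_iff)
    qed
    with v w show "v = w"
      by (simp add: nth_equalityI)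
  qed
  moreover have "?run ` ?W \<subseteq> states M"
    using assms(2) by (auto intro: foldl_step_in_states simp: is_dfa_def)
  moreover have "finite (states M)"
    using assms(2) by (simp add: is_dfa_def)
  ultimately have "card ?W \<le> card (states M)"
    by (rule card_inj_on_le)
  moreover have "card ?W = 2 ^ (2 * k)"
    using card_lists_length_eq[of "UNIV :: bool set" "2 * k"] by simp
  ultimately show ?thesis by simp
qed

end
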